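(* Let $G$ be a connected $\{P_6,\text{dart},K_4\}$-free graph with no clique cutset, and let $H$ be an induced diamond in $G$ with $V(H)=\{u_1,u_2,u_3,u_4\}$ and $E(H)=\{u_1u_2,u_2u_3,u_3u_4,u_4u_1,u_1u_3\}$. Let $A_2,B_{13},C_2,C_4$, the auxiliary graph $S$ on vertex set $A_2$, and the graph $\Gamma$ be as defined in the context, and assume $C_2=C_4=\emptyset$ and $B_{13}\neq\emptyset$. Then $\Gamma$ is bipartite.
   Context: All graphs are finite, simple and undirected. $P_6$ is the path on $6$ vertices. A diamond is $K_4$ minus an edge; a dart is the graph obtained from a diamond by adding a new vertex adjacent to exactly one vertex of the diamond, that vertex being one of degree $3$ in the diamond. $\{P_6,\text{dart},K_4\}$-free means having no induced subgraph isomorphic to $P_6$, the dart, or $K_4$. A clique cutset of $G$ is a clique $K\subseteq V(G)$ such that $G\setminus K$ has more components than $G$. $G[X]$ is the subgraph induced by $X$; components of $G[X]$ are identified with their vertex sets. For $x\in V(G)\setminus V(H)$ write $N_H(x)=N(x)\cap V(H)$. Define $A_2=\{x\in V(G)\setminus V(H):N_H(x)=\{u_2\}\}$, $B_{13}=\{x\in V(G)\setminus V(H):N_H(x)=\{u_1,u_3\}\}$, $C_2=\{x\in V(G)\setminus V(H):N_H(x)=\{u_2,u_3,u_4\}\}$, $C_4=\{x\in V(G)\setminus V(H):N_H(x)=\{u_4,u_1,u_2\}\}$, $Z=\{x\in V(G)\setminus V(H):N_H(x)=\emptyset\}$. $Z_1$ is the union of those components of $G[Z]$ that have a neighbor in $A_2$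 (i.e. contain a vertex adjacent to some vertex of $A_2$). A component $Q=\{q,q'\}$ of $G[Z_1]$ (with exactly two vertices) is called bad if $qq'\in E(G)$ and both $q$ and $q'$ have a neighbor in $B_{13}$. For a component $Q$ of $G[Z_1]$, $N_{A_2}(Q)$ is the set of vertices of $A_2$ having a neighbor in $Q$. The auxiliary graph $S$ has vertex set $A_2$; for distinct $x,y\in A_2$, $xy\in E(S)$ if and only if there exists a bad component $Q$ of $G[Z_1]$ such that $x,y\in N_{A_2}(Q)$. $\Gamma$ is the graph obtained by contracting each component of $S$ to a single vertex (so the vertices of $\Gamma$ are the components of $S$) and adding an edge between two components whenever there is an edge of $G[A_2]$ with one end in each component. *)

theory Defs
  imports Main
begin

datatype (dead 'a) graph = Graph (verts: "'a set") (edges: "'a set set")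

definition simple_graph :: "'a graph \<Rightarrow> bool" where
  "simple_graph G \<longleftrightarrow>
     finite (verts G) \<and> (\<forall>e \<in> edges G. e \<subseteq> verts G \<and> card e = 2)"

definition adj :: "'a graph \<Rightarrow> 'a \<Rightarrow> 'a \<Rightarrow> bool" where
  "adj G x y \<longleftrightarrow> {x, y} \<in> edges G"

definition induced :: "'a graph \<Rightarrow> 'a set \<Rightarrow> 'a graph" where
  "induced G X = Graph (verts G \<inter> X) {e \<in> edges G. e \<subseteq> X}"

definition graph_iso :: "'a graph \<Rightarrow> 'b graph \<Rightarrow> bool" where
  "graph_iso G F \<longleftrightarrow>
     (\<exists>f. bij_betw f (verts G) (verts F) \<and>
       (\<forall>x \<in> verts G. \<forall>y \<in> verts G. adj G x y \<longleftrightarrow> adj F (f x) (f y)))"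

definition free_of :: "'b graph \<Rightarrow> 'a graph \<Rightarrow> bool" where
  "free_of F G \<longleftrightarrow> \<not> (\<exists>X \<subseteq> verts G. graph_iso (induced G X) F)"

definition P6 :: "nat graph" where
  "P6 = Graph {1..6} {{i, i + 1} | i. 1 \<le> i \<and> i \<le> 5}"

definition K4 :: "nat graph" where
  "K4 = Graph {1..4} {{i, j} | i j. i \<in> {1..4} \<and> j \<in> {1..4} \<and> i \<noteq> j}"

definition diamond :: "nat graph" where
  "diamond = Graph (verts K4) (edges K4 - {{2, 4}})"

text \<open>In \<^const>\<open>diamond\<close> the vertices 1 and 3 have degree 3.\<close>

definition dart :: "nat graph" where
  "dart = Graph (insert 5 (verts diamond)) (insert {1, 5} (edges diamond))"

definition component_of :: "'a graph \<Rightarrow> 'a \<Rightarrow> 'a set" where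
  "component_of G x = {y \<in> verts G. (adj G)\<^sup>*\<^sup>* x y}"

definition components :: "'a graph \<Rightarrow> 'a set set" where
  "components G = component_of G ` verts G"

definition connected_graph :: "'a graph \<Rightarrow> bool" where
  "connected_graph G \<longleftrightarrow>
     verts G \<noteq> {} \<and> (\<forall>x \<in> verts G. \<forall>y \<in> verts G. (adj G)\<^sup>*\<^sup>* x y)"

definition clique :: "'a graph \<Rightarrow> 'a set \<Rightarrow> bool" where
  "clique G K \<longleftrightarrow> K \<subseteq> verts G \<and> (\<forall>x \<in> K. \<forall>y \<in> K. x \<noteq> y \<longrightarrow> adj G x y)"

definition clique_cutset :: "'a graph \<Rightarrow> 'a set \<Rightarrow> bool" where
  "clique_cutset G K \<longleftrightarrow>
     clique G K \<and>
     card (components (induced G (verts G - K))) > card (components G)"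

definition bipartite :: "'a graph \<Rightarrow> bool" where
  "bipartite G \<longleftrightarrow>
     (\<exists>X Y. X \<union> Y = verts G \<and> X \<inter> Y = {} \<and>
       (\<forall>e \<in> edges G. \<exists>x \<in> X. \<exists>y \<in> Y. e = {x, y}))"

definition nbrs_in :: "'a graph \<Rightarrow> 'a graph \<Rightarrow> 'a \<Rightarrow> 'a set" where
  "nbrs_in G H x = {y \<in> verts H. adj G x y}"

text \<open>The sets A_2, B_13, C_2, C_4 and Z are the instances of the following with
  U being {u_2}, {u_1, u_3}, {u_2, u_3, u_4}, {u_4, u_1, u_2} and the empty set.\<close>

definition attached :: "'a graph \<Rightarrow> 'a graph \<Rightarrow> 'a set \<Rightarrow> 'a set" where
  "attached G H U = {x \<in> verts G - verts H. nbrs_in G H x = U}"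

definition set_nbrs :: "'a graph \<Rightarrow> 'a set \<Rightarrow> 'a set \<Rightarrow> 'a set" where
  "set_nbrs G A Q = {a \<in> A. \<exists>q \<in> Q. adj G a q}"

definition Z1 :: "'a graph \<Rightarrow> 'a graph \<Rightarrow> 'a set \<Rightarrow> 'a set" where
  "Z1 G H A = \<Union> {Q \<in> components (induced G (attached G H {})). set_nbrs G A Q \<noteq> {}}"

definition bad_component ::
    "'a graph \<Rightarrow> 'a graph \<Rightarrow> 'a set \<Rightarrow> 'a set \<Rightarrow> 'a set \<Rightarrow> bool" where
  "bad_component G H A B Q \<longleftrightarrow>
     Q \<in> components (induced G (Z1 G H A)) \<and>
     (\<exists>q q'. q \<noteq> q' \<and> Q = {q, q'} \<and> adj G q q' \<and>
       (\<exists>b \<in> B. adj G q b) \<and> (\<exists>b \<in> B. adj G q' b))"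

definition aux_graph :: "'a graph \<Rightarrow> 'a graph \<Rightarrow> 'a set \<Rightarrow> 'a set \<Rightarrow> 'a graph" where
  "aux_graph G H A B =
     Graph A {{x, y} | x y. x \<in> A \<and> y \<in> A \<and> x \<noteq> y \<and>
       (\<exists>Q. bad_component G H A B Q \<and> x \<in> set_nbrs G A Q \<and> y \<in> set_nbrs G A Q)}"

text \<open>The contracted graph is simple: edges of G[A] inside one component of S do not
  give loops.\<close>

definition contracted :: "'a graph \<Rightarrow> 'a set \<Rightarrow> 'a graph \<Rightarrow> 'a set graph" where
  "contracted G A S =
     Graph (components S)
       {{C, D} | C D. C \<in> components S \<and> D \<in> components S \<and> C \<noteq> D \<and>
          (\<exists>x \<in> C. \<exists>y \<in> D. adj (induced G A) x y)}"

end

theory Submission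
  imports Defs
begin

text \<open>
  Excluding the dart and
  \<open>K\<^sub>4\<close> makes \<open>G[A\<^sub>2]\<close> a disjoint union of edges and isolated vertices (lemma
  \<open>A_matching\<close>), because all of \<open>A\<^sub>2\<close> is joined to \<open>u\<^sub>2\<close> and none of it to \<open>u\<^sub>1\<close>. Excluding
  \<open>P\<^sub>6\<close> makes a vertex of \<open>A\<^sub>2\<close> adjacent to both or to neither of the vertices of a bad
  component.

  Say that a vertex of \<open>A\<^sub>2\<close> is touched if it has a neighbour in some bad component. If some
  vertex is touched, fix a bad component \<open>Q\<^sub>0\<close> with a neighbour in \<open>A\<^sub>2\<close>, and one single
  vertex \<open>b\<close> of \<open>B\<^sub>1\<^sub>3\<close> with a neighbour in \<open>Q\<^sub>0\<close>. Colour \<open>x \<in> A\<^sub>2\<close> by whether \<open>x\<close> is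
  adjacent to \<open>b\<close>. This colouring
    \<^item> is constant on the components of \<open>S\<close>, since \<open>b\<close> does not distinguish two
      neighbours of the same bad component (\<open>B_homogeneous\<close>);
    \<^item> separates the ends of every edge \<open>xx'\<close> of \<open>G[A\<^sub>2]\<close> with \<open>x\<close> touched: \<open>b\<close> cannot
      see both ends (\<open>B_not_both\<close>), and if \<open>b\<close> misses \<open>x\<close>, then it has a neighbour in each
      bad component \<open>Q\<close> next to \<open>x\<close> (\<open>B_reaches\<close>), which in turn forces \<open>b\<close> to be adjacent
      to \<open>x'\<close> (\<open>B_partner\<close>).
  The remaining edges of \<open>G[A\<^sub>2]\<close> join two untouched vertices, which are singleton
  components of \<open>S\<close>; as \<open>G[A\<^sub>2]\<close> is a matching, these edges can be coloured independently of
  everything else.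
\<close>

section \<open>Forbidden induced subgraphs as adjacency patterns\<close>

lemma adj_commute: "adj G x y \<longleftrightarrow> adj G y x"
  by (simp add: adj_def insert_commute)

lemma adj_irrefl: "simple_graph G \<Longrightarrow> \<not> adj G x x"
  by (force simp: adj_def simple_graph_def)

lemma adj_imp_verts: "simple_graph G \<Longrightarrow> adj G x y \<Longrightarrow> x \<in> verts G \<and> y \<in> verts G"
  by (force simp: adj_def simple_graph_def)

lemma adj_induced: "adj (induced G X) x y \<longleftrightarrow> adj G x y \<and> x \<in> X \<and> y \<in> X"
  by (auto simp: adj_def induced_def)

lemma verts_induced: "verts (induced G X) = verts G \<inter> X"
  by (simp add: induced_def)

lemma not_free_of_pattern:
  fixes F :: "nat graph"
  assumes "distinct vs" "set vs \<subseteq> verts G" "verts F = {1..length vs}"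
    and adj: "\<And>i j. i < length vs \<Longrightarrow> j < length vs \<Longrightarrow>
      adj G (vs ! i) (vs ! j) \<longleftrightarrow> adj F (Suc i) (Suc j)"
  shows "\<not> free_of F G"
proof -
  let ?n = "length vs"
  define g where "g = the_inv_into {..<?n} ((!) vs)"
  have inj: "inj_on ((!) vs) {..<?n}"
    using assms(1) by (simp add: inj_on_nth)
  have img: "(!) vs ` {..<?n} = set vs"
    by (auto simp: set_conv_nth)
  have g: "bij_betw g (set vs) {..<?n}"
    unfolding g_def using bij_betw_the_inv_into[of "(!) vs" "{..<?n}" "set vs"] inj img
    by (simp add: bij_betw_def)
  have "bij_betw Suc {..<?n} {1..?n}"
    by (auto simp: bij_betw_def image_Suc_lessThan)
  then have bij: "bij_betw (Suc \<circ> g) (set vs) {1..?n}"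
    using g by (rule bij_betw_trans[rotated])
  have g_lt: "g x < ?n" and g_nth: "vs ! g x = x" if "x \<in> set vs" for x
    using that g bij_betwE[OF g] f_the_inv_into_f[OF inj, of x] img
    by (auto simp: g_def)
  have "adj (induced G (set vs)) x y \<longleftrightarrow> adj F ((Suc \<circ> g) x) ((Suc \<circ> g) y)"
    if "x \<in> set vs" "y \<in> set vs" for x y
    using adj[OF g_lt g_lt] that by (simp add: g_nth adj_induced)
  moreover have "verts (induced G (set vs)) = set vs"
    using assms(2) by (auto simp: verts_induced)
  ultimately have "graph_iso (induced G (set vs)) F"
    unfolding graph_iso_def using bij assms(3) by (intro exI[of _ "Suc \<circ> g"]) simp
  then show ?thesis
    using assms(2) by (auto simp: free_of_def)
qed

lemma adj_P6: "adj P6 i j \<longleftrightarrow> i \<in> {1..6} \<and> j \<in> {1..6} \<and> (j = Suc i \<or> i = Suc j)"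
  by (auto simp: adj_def P6_def doubleton_eq_iff)

lemma adj_K4: "adj K4 i j \<longleftrightarrow> i \<in> {1..4} \<and> j \<in> {1..4} \<and> i \<noteq> j"
  by (auto simp: adj_def K4_def doubleton_eq_iff)

lemma adj_dart: "adj dart i j \<longleftrightarrow>
    i \<in> {1..4} \<and> j \<in> {1..4} \<and> i \<noteq> j \<and> {i, j} \<noteq> {2, 4} \<or> {i, j} = {1, 5}"
  using adj_K4[of i j] by (auto simp: adj_def dart_def diamond_def)

lemma P6_free_contra:
  assumes "simple_graph G" "free_of P6 G"
    and "distinct [a, b, c, d, e, f]" "{a, b, c, d, e, f} \<subseteq> verts G"
    and "adj G a b" "adj G b c" "adj G c d" "adj G d e" "adj G e f"
    and "\<not> adj G a c" "\<not> adj G a d" "\<not> adj G a e" "\<not> adj G a f" "\<not> adj G b d"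
      "\<not> adj G b e" "\<not> adj G b f" "\<not> adj G c e" "\<not> adj G c f" "\<not> adj G d f"
  shows False
proof -
  have "\<not> free_of P6 G"
  proof (rule not_free_of_pattern[of "[a, b, c, d, e, f]"])
    fix i j
    assume "i < length [a, b, c, d, e, f]" "j < length [a, b, c, d, e, f]"
    then have "i \<in> {0, 1, 2, 3, 4, 5}" "j \<in> {0, 1, 2, 3, 4, 5}"
      by auto
    then show "adj G ([a, b, c, d, e, f] ! i) ([a, b, c, d, e, f] ! j)
        \<longleftrightarrow> adj P6 (Suc i) (Suc j)"
      using assms(5-) adj_irrefl[OF assms(1)]
      by (elim insertE emptyE) (simp_all add: adj_P6 adj_commute)
  qed (use assms in \<open>auto simp: P6_def\<close>)
  with assms(2) show False by simp
qed

lemma K4_free_contra: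
  assumes "simple_graph G" "free_of K4 G"
    and "adj G a b" "adj G a c" "adj G a d" "adj G b c" "adj G b d" "adj G c d"
  shows False
proof -
  have "\<not> free_of K4 G"
  proof (rule not_free_of_pattern[of "[a, b, c, d]"])
    fix i j
    assume "i < length [a, b, c, d]" "j < length [a, b, c, d]"
    then have "i \<in> {0, 1, 2, 3}" "j \<in> {0, 1, 2, 3}"
      by auto
    then show "adj G ([a, b, c, d] ! i) ([a, b, c, d] ! j) \<longleftrightarrow> adj K4 (Suc i) (Suc j)"
      using assms(3-) adj_irrefl[OF assms(1)]
      by (elim insertE emptyE) (simp_all add: adj_K4 adj_commute)
  next
    show "distinct [a, b, c, d]"
      using assms(3-) adj_irrefl[OF assms(1)] by auto
  next
    show "set [a, b, c, d] \<subseteq> verts G"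
      using assms(3-) adj_imp_verts[OF assms(1)] by auto
  qed (simp add: K4_def)
  with assms(2) show False by simp
qed

text \<open>The diamond has the vertices \<open>a, c\<close> of degree 3 and \<open>b, d\<close> of degree 2; the vertex
  \<open>e\<close> is pendant at \<open>a\<close>.\<close>

lemma dart_free_contra:
  assumes "simple_graph G" "free_of dart G" and "b \<noteq> d"
    and "adj G a c" "adj G a b" "adj G a d" "adj G c b" "adj G c d" "adj G a e"
    and "\<not> adj G b d" "\<not> adj G b e" "\<not> adj G c e" "\<not> adj G d e"
  shows False
proof -
  have "\<not> free_of dart G"
  proof (rule not_free_of_pattern[of "[a, b, c, d, e]"])
    fix i j
    assume "i < length [a, b, c, d, e]" "j < length [a, b, c, d, e]"
    then have "i \<in> {0, 1, 2, 3, 4}" "j \<in> {0, 1, 2, 3, 4}"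
      by auto
    then show "adj G ([a, b, c, d, e] ! i) ([a, b, c, d, e] ! j) \<longleftrightarrow> adj dart (Suc i) (Suc j)"
      using assms(3-) adj_irrefl[OF assms(1)]
      by (elim insertE emptyE) (simp_all add: adj_dart adj_commute doubleton_eq_iff)
  next
    show "distinct [a, b, c, d, e]"
      using assms(3-) adj_irrefl[OF assms(1)] by (auto simp: adj_commute)
  next
    show "set [a, b, c, d, e] \<subseteq> verts G"
      using assms(3-) adj_imp_verts[OF assms(1)] by auto
  qed (auto simp: dart_def diamond_def K4_def)
  with assms(2) show False by simp
qed

section \<open>Components\<close>

lemma component_adj_closed:
  assumes "simple_graph G" "Q \<in> components (induced G X)" "R \<in> components (induced G X)"
    and "q \<in> Q" "r \<in> R" "q = r \<or> adj G q r"
  shows "Q = R"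
proof -
  let ?I = "induced G X"
  obtain x y where x: "Q = component_of ?I x" and y: "R = component_of ?I y"
    using assms(2,3) by (auto simp: components_def)
  have sym: "symp ((adj ?I)\<^sup>*\<^sup>*)"
    by (rule symp_rtranclp) (auto simp: symp_def adj_commute)
  have qr: "q \<in> X" "r \<in> X" and xq: "(adj ?I)\<^sup>*\<^sup>* x q" and yr: "(adj ?I)\<^sup>*\<^sup>* y r"
    using assms(4,5) x y by (auto simp: component_of_def verts_induced)
  have "(adj ?I)\<^sup>*\<^sup>* q r"
    using assms(6) qr by (auto simp: adj_induced)
  then have xy: "(adj ?I)\<^sup>*\<^sup>* x y" and yx: "(adj ?I)\<^sup>*\<^sup>* y x"
    using xq yr sym by (meson rtranclp_trans sympD)+
  show ?thesis
    unfolding x y component_of_def using xy yx by (auto intro: rtranclp_trans)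
qed

section \<open>The structure around a diamond\<close>

locale diamond_in_graph =
  fixes G H :: "'a graph" and u1 u2 u3 u4 :: 'a
  assumes simple: "simple_graph G"
    and P6_free: "free_of P6 G" and dart_free: "free_of dart G" and K4_free: "free_of K4 G"
    and u_verts: "{u1, u2, u3, u4} \<subseteq> verts G"
    and H_def: "H = induced G {u1, u2, u3, u4}"
    and u_distinct: "distinct [u1, u2, u3, u4]"
    and u_adj: "adj G u1 u2" "adj G u1 u4"
    and u24: "\<not> adj G u2 u4"
begin

abbreviation A where "A \<equiv> attached G H {u2}"
abbreviation B where "B \<equiv> attached G H {u1, u3}"
abbreviation Z where "Z \<equiv> attached G H {}"
abbreviation bad where "bad \<equiv> bad_component G H A B"
abbreviation N where "N \<equiv> set_nbrs G A"

lemmas P6_contra = P6_free_contra[OF simple P6_free]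
lemmas K4_contra = K4_free_contra[OF simple K4_free]
lemmas dart_contra = dart_free_contra[OF simple dart_free]
lemmas commute = adj_commute[of G]

lemma verts_H: "verts H = {u1, u2, u3, u4}"
  using u_verts by (auto simp: H_def verts_induced)

lemma attached_D:
  assumes "x \<in> attached G H U"
  shows "x \<in> verts G" "x \<notin> {u1, u2, u3, u4}"
    "y \<in> {u1, u2, u3, u4} \<Longrightarrow> adj G x y \<longleftrightarrow> y \<in> U"
  using assms by (auto simp: attached_def nbrs_in_def verts_H)

lemma A_D:
  assumes "x \<in> A"
  shows "x \<in> verts G" "x \<noteq> u1" "x \<noteq> u2" "x \<noteq> u4"
    "adj G x u2" "\<not> adj G x u1" "\<not> adj G x u4"
  using attached_D[OF assms] u_distinct by auto

lemma B_D:
  assumes "x \<in> B"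
  shows "x \<in> verts G" "x \<noteq> u1" "x \<noteq> u2" "x \<noteq> u4"
    "adj G x u1" "\<not> adj G x u2" "\<not> adj G x u4"
  using attached_D[OF assms] u_distinct by auto

lemma Z_D:
  assumes "x \<in> Z"
  shows "x \<in> verts G" "x \<noteq> u1" "x \<noteq> u2" "x \<noteq> u4"
    "\<not> adj G x u1" "\<not> adj G x u2" "\<not> adj G x u4"
  using attached_D[OF assms] u_distinct by auto

text \<open>Two neighbours \<open>x, z\<close> of \<open>y\<close> in \<open>A\<^sub>2\<close> would give a \<open>K\<^sub>4\<close> with \<open>u\<^sub>2\<close> if adjacent, and
  otherwise a diamond with pendant vertex \<open>u\<^sub>1\<close> at \<open>u\<^sub>2\<close>.\<close>

lemma A_matching:
  assumes "x \<in> A" "y \<in> A" "z \<in> A" "adj G y x" "adj G y z"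
  shows "x = z"
proof (rule ccontr)
  assume "x \<noteq> z"
  note D = A_D[OF assms(1)] A_D[OF assms(2)] A_D[OF assms(3)]
  show False
  proof (cases "adj G x z")
    case True
    then show False
      using K4_contra[of u2 x y z] D assms by (auto simp: commute)
  next
    case False
    then show False
      using dart_contra[of x z u2 y u1] D assms u_adj \<open>x \<noteq> z\<close> by (auto simp: commute)
  qed
qed

text \<open>A bad component \<open>{q, q'}\<close> lies in \<open>Z\<close>, and \<open>P\<^sub>6\<close>-freeness makes each of its neighbours
  in \<open>A\<^sub>2\<close> adjacent to both of its vertices: otherwise \<open>u\<^sub>4u\<^sub>1u\<^sub>2xqq'\<close> is an induced path.\<close>

lemma A_complete:
  assumes "x \<in> A" "q \<in> Z" "r \<in> Z" "adj G x q" "adj G q r"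
  shows "adj G x r"
proof (rule ccontr)
  assume xr: "\<not> adj G x r"
  note D = A_D[OF assms(1)] Z_D[OF assms(2)] Z_D[OF assms(3)]
  have "x \<noteq> q" "x \<noteq> r" "q \<noteq> r"
    using D assms xr commute adj_irrefl[OF simple] by blast+
  then show False
    using P6_contra[of u4 u1 u2 x q r] D assms xr u_adj u24 u_verts u_distinct by (auto simp: commute)
qed

lemma Z1_subset: "Z1 G H A \<subseteq> Z"
  by (auto simp: Z1_def components_def component_of_def verts_induced)

lemma bad_subset: "bad Q \<Longrightarrow> Q \<subseteq> Z"
  using Z1_subset
  by (auto simp: bad_component_def components_def component_of_def verts_induced)

text \<open>A given vertex \<open>q\<close> of a bad component may play the role of either of its two
  vertices; \<open>q'\<close> is the other one.\<close>

lemma bad_neighbourE: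
  assumes "bad Q" "x \<in> N Q" "q \<in> Q"
  obtains q' where "q \<in> Z" "q' \<in> Z" "q' \<in> Q" "adj G q q'" "x \<in> A" "adj G x q" "adj G x q'"
proof -
  obtain r r' where r: "r \<noteq> r'" "Q = {r, r'}" "adj G r r'"
    using assms(1) by (auto simp: bad_component_def)
  have rZ: "r \<in> Z" "r' \<in> Z"
    using bad_subset[OF assms(1)] r by auto
  have x: "x \<in> A" "adj G x r \<or> adj G x r'"
    using assms(2) r by (auto simp: set_nbrs_def)
  have "adj G x r" "adj G x r'"
    using x A_complete[OF x(1)] rZ r(3) commute by blast+
  then show thesis
    using that[of r] that[of r'] r rZ x assms(3) by (auto simp: commute)
qed

lemma bad_separated:
  assumes "bad Q" "bad R" "q \<in> Q" "r \<in> R" "Q \<noteq> R"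
  shows "q \<noteq> r" "\<not> adj G q r"
  using assms component_adj_closed[OF simple, of Q "Z1 G H A" R q r]
  by (auto simp: bad_component_def)

lemma N_independent:
  assumes "bad Q" "x \<in> N Q" "y \<in> N Q"
  shows "\<not> adj G x y"
proof
  assume xy: "adj G x y"
  obtain q where q: "q \<in> Q"
    using assms(1) by (auto simp: bad_component_def)
  obtain q' where q': "q' \<in> Q" "adj G q q'" "adj G x q" "adj G x q'"
    using bad_neighbourE[OF assms(1,2) q] by blast
  moreover have "adj G y q" "adj G y q'"
    using bad_neighbourE[OF assms(1,3)] q q' by blast+
  ultimately show False
    using K4_contra[of x y q q'] xy by blast
qed

text \<open>If \<open>b\<close> were adjacent to \<open>x\<close>, then \<open>b, x, q, q'\<close> would form a \<open>K\<^sub>4\<close>, or a diamond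
  with pendant vertex \<open>u\<^sub>2\<close> at \<open>x\<close>.\<close>

lemma B_misses_neighbours:
  assumes "bad Q" "x \<in> N Q" "b \<in> B" "q \<in> Q" "adj G b q"
  shows "\<not> adj G b x"
proof
  assume bx: "adj G b x"
  obtain q' where q': "q \<in> Z" "q' \<in> Z" "adj G q q'" "x \<in> A" "adj G x q" "adj G x q'"
    using bad_neighbourE[OF assms(1,2,4)] by blast
  note D = A_D[OF q'(4)] B_D[OF assms(3)] Z_D[OF q'(1)] Z_D[OF q'(2)]
  show False
  proof (cases "adj G b q'")
    case True
    then show False
      using K4_contra[of b x q q'] q' assms bx by blast
  next
    case False
    have "b \<noteq> q'" using D by auto
    then show False
      using dart_contra[of b q' x q u2] q' D assms bx False by (auto simp: commute)
  qed
qed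

text \<open>Otherwise \<open>x'xqbu\<^sub>1u\<^sub>4\<close> is an induced path.\<close>

lemma B_partner:
  assumes "bad Q" "x \<in> N Q" "b \<in> B" "q \<in> Q" "adj G b q" "x' \<in> A" "adj G x x'"
  shows "adj G b x'"
proof (rule ccontr)
  assume bx': "\<not> adj G b x'"
  have q: "q \<in> Z" "x \<in> A" "adj G x q"
    using bad_neighbourE[OF assms(1,2,4)] by blast+
  note D = A_D[OF q(2)] A_D[OF assms(6)] B_D[OF assms(3)] Z_D[OF q(1)]
  have bx: "\<not> adj G b x"
    using B_misses_neighbours[OF assms(1-5)] .
  have x'q: "\<not> adj G x' q"
    using N_independent[OF assms(1,2), of x'] assms by (auto simp: set_nbrs_def)
  have "x' \<noteq> x" "x' \<noteq> q" "x' \<noteq> b" "x \<noteq> q" "x \<noteq> b" "q \<noteq> b"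
    using adj_irrefl[OF simple] assms D by metis+
  then show False
    using P6_contra[of x' x q b u1 u4] D assms q bx bx' x'q u_adj u_verts u_distinct
    by (auto simp: commute)
qed

text \<open>Otherwise \<open>u\<^sub>2, x, x', b\<close> form a diamond, and a neighbour of \<open>x\<close> in \<open>Q\<close> is pendant at
  \<open>x\<close>.\<close>

lemma B_not_both:
  assumes "bad Q" "x \<in> N Q" "x' \<in> A" "adj G x x'" "b \<in> B" "adj G b x"
  shows "\<not> adj G b x'"
proof
  assume bx': "adj G b x'"
  obtain q where qQ: "q \<in> Q"
    using assms(1) by (auto simp: bad_component_def)
  have q: "q \<in> Z" "x \<in> A" "adj G x q"
    using bad_neighbourE[OF assms(1,2) qQ] by blast+
  note D = A_D[OF q(2)] A_D[OF assms(3)] B_D[OF assms(5)] Z_D[OF q(1)]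
  have bq: "\<not> adj G b q"
    using B_misses_neighbours[OF assms(1,2,5) qQ] assms(6) by blast
  have x'q: "\<not> adj G x' q"
    using N_independent[OF assms(1,2), of x'] assms qQ by (auto simp: set_nbrs_def)
  show False
    using dart_contra[of b u2 x x' q] D assms q bq bx' x'q by (auto simp: commute)
qed

text \<open>Otherwise \<open>yqxbu\<^sub>1u\<^sub>4\<close> is an induced path.\<close>

lemma B_homogeneous:
  assumes "bad Q" "x \<in> N Q" "y \<in> N Q" "b \<in> B" "adj G b x"
  shows "adj G b y"
proof (rule ccontr)
  assume by': "\<not> adj G b y"
  obtain q where qQ: "q \<in> Q"
    using assms(1) by (auto simp: bad_component_def)
  have q: "q \<in> Z" "x \<in> A" "adj G x q" "y \<in> A" "adj G y q"
    using bad_neighbourE[OF assms(1,2) qQ] bad_neighbourE[OF assms(1,3) qQ] by blast+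
  note D = A_D[OF q(2)] A_D[OF q(4)] B_D[OF assms(4)] Z_D[OF q(1)]
  have bq: "\<not> adj G b q"
    using B_misses_neighbours[OF assms(1,2,4) qQ] assms(5) by blast
  have xy: "\<not> adj G y x"
    using N_independent[OF assms(1,3,2)] .
  have "y \<noteq> q" "y \<noteq> x" "y \<noteq> b" "q \<noteq> x" "q \<noteq> b" "x \<noteq> b"
    using adj_irrefl[OF simple] assms D q by' by metis+
  then show False
    using P6_contra[of y q x b u1 u4] D assms q bq by' xy u_adj u_verts u_distinct
    by (auto simp: commute)
qed

text \<open>Otherwise \<open>u\<^sub>4u\<^sub>1bqyr\<close> is an induced path.\<close>

lemma B_spreads:
  assumes "bad Q" "bad R" "y \<in> N Q" "y \<in> N R" "b \<in> B" "q \<in> Q" "adj G b q" "r \<in> R"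
    and "Q \<noteq> R"
  shows "adj G b r"
proof (rule ccontr)
  assume br: "\<not> adj G b r"
  have q: "q \<in> Z" "r \<in> Z" "y \<in> A" "adj G y q" "adj G y r"
    using bad_neighbourE[OF assms(1,3,6)] bad_neighbourE[OF assms(2,4,8)] by blast+
  note D = A_D[OF q(3)] B_D[OF assms(5)] Z_D[OF q(1)] Z_D[OF q(2)]
  have "\<not> adj G b y"
    using B_misses_neighbours[OF assms(1,3,5,6,7)] .
  moreover have "q \<noteq> r" "\<not> adj G q r"
    using bad_separated[OF assms(1,2,6,8,9)] by auto
  moreover have "b \<noteq> q" "b \<noteq> y" "b \<noteq> r" "q \<noteq> y" "y \<noteq> r"
    using adj_irrefl[OF simple] assms D q by metis+
  ultimately show False
    using P6_contra[of u4 u1 b q y r] D assms q br u_adj u_verts u_distinct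
    by (auto simp: commute)
qed

text \<open>If \<open>b\<close> had no neighbour in \<open>R\<close>, then \<open>bqwu\<^sub>2xr\<close> would be an induced path, where \<open>w\<close> is
  a neighbour of \<open>Q\<close> in \<open>A\<^sub>2\<close>: by \<open>B_spreads\<close>, \<open>Q\<close> and \<open>R\<close> have no common neighbour in
  \<open>A\<^sub>2\<close>, and \<open>w\<close> is not adjacent to \<open>x\<close> by \<open>B_partner\<close>. This is what allows a single vertex \<open>b\<close> to colour all
  components.\<close>

lemma B_reaches:
  assumes "bad Q" "bad R" "w \<in> N Q" "x \<in> N R" "b \<in> B" "q \<in> Q" "adj G b q"
    and bx: "\<not> adj G b x"
  shows "\<exists>r \<in> R. adj G b r"
proof (rule ccontr)
  assume none: "\<not> (\<exists>r \<in> R. adj G b r)"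
  then have QR: "Q \<noteq> R"
    using assms by blast
  obtain r where rR: "r \<in> R"
    using assms(2) by (auto simp: bad_component_def)
  have q: "q \<in> Z" "r \<in> Z" "w \<in> A" "x \<in> A" "adj G w q" "adj G x r"
    using bad_neighbourE[OF assms(1,3,6)] bad_neighbourE[OF assms(2,4) rR] by blast+
  note D = A_D[OF q(3)] A_D[OF q(4)] B_D[OF assms(5)] Z_D[OF q(1)] Z_D[OF q(2)]
  have br: "\<not> adj G b r"
    using none rR by blast
  have disj: "y \<notin> N R" if "y \<in> N Q" for y
    using B_spreads[OF assms(1,2) that _ assms(5,6,7) rR QR] br by blast
  have xq: "\<not> adj G x q" and wr: "\<not> adj G w r"
    using disj[of x] disj[OF assms(3)] assms(4,6) q rR by (auto simp: set_nbrs_def)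
  have wx: "\<not> adj G w x"
    using B_partner[OF assms(1,3,5,6,7) q(4)] bx by blast
  have bw: "\<not> adj G b w"
    using B_misses_neighbours[OF assms(1,3,5,6,7)] .
  have qr: "q \<noteq> r" "\<not> adj G q r"
    using bad_separated[OF assms(1,2,6) rR QR] by auto
  have ne: "b \<noteq> q" "b \<noteq> w" "b \<noteq> x" "b \<noteq> r" "q \<noteq> w" "q \<noteq> x" "w \<noteq> x" "w \<noteq> r" "x \<noteq> r"
    using adj_irrefl[OF simple] assms D q wr by metis+
  show False
    using P6_contra[of b q w u2 x r] ne qr D assms(7) q br bx bw wx wr xq u_verts
    by (auto simp: commute)
qed

text \<open>A vertex of \<open>A\<^sub>2\<close> is touched if it has a neighbour in some bad component; the other
  vertices of \<open>A\<^sub>2\<close> are isolated in \<open>S\<close>.\<close>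

definition touched :: "'a \<Rightarrow> bool" where
  "touched x \<longleftrightarrow> (\<exists>Q. bad Q \<and> x \<in> N Q)"

lemma touched_colouring:
  obtains c :: "'a \<Rightarrow> bool" where "\<And>x y Q. bad Q \<Longrightarrow> x \<in> N Q \<Longrightarrow> y \<in> N Q \<Longrightarrow> c x = c y"
    and "\<And>x y. touched x \<Longrightarrow> y \<in> A \<Longrightarrow> adj G x y \<Longrightarrow> c x \<noteq> c y"
proof (cases "\<exists>x. touched x")
  case False
  show thesis
    using that[of "\<lambda>_. True"] False by blast
next
  case True
  then obtain Q0 w where Q0: "bad Q0" "w \<in> N Q0"
    by (auto simp: touched_def)
  then obtain q0 b where b: "b \<in> B" "q0 \<in> Q0" "adj G b q0"
    using commute by (auto simp: bad_component_def)
  show thesis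
  proof (rule that[of "adj G b"])
    show "adj G b x = adj G b y" if "bad Q" "x \<in> N Q" "y \<in> N Q" for x y Q
      using B_homogeneous that b(1) by blast
    show "adj G b x \<noteq> adj G b y" if x: "touched x" and y: "y \<in> A" "adj G x y" for x y
    proof -
      obtain Q where Q: "bad Q" "x \<in> N Q"
        using x by (auto simp: touched_def)
      have "adj G b y" if bx: "\<not> adj G b x"
      proof -
        obtain r where "r \<in> Q" "adj G b r"
          using B_reaches[OF Q0(1) Q(1) Q0(2) Q(2) b bx] by blast
        then show ?thesis
          using B_partner[OF Q b(1) _ _ y] by blast
      qed
      then show ?thesis
        using B_not_both[OF Q y b(1)] by blast
    qed
  qed
qed

text \<open>An edge between untouched vertices is coloured by comparing the images of its ends
  under an injection into the natural numbers.\<close>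

lemma colouring:
  obtains c :: "'a \<Rightarrow> bool" where "\<And>x y Q. bad Q \<Longrightarrow> x \<in> N Q \<Longrightarrow> y \<in> N Q \<Longrightarrow> c x = c y"
    and "\<And>x y. x \<in> A \<Longrightarrow> y \<in> A \<Longrightarrow> adj G x y \<Longrightarrow> c x \<noteq> c y"
proof -
  obtain c :: "'a \<Rightarrow> bool" where c: "\<And>x y Q. bad Q \<Longrightarrow> x \<in> N Q \<Longrightarrow> y \<in> N Q \<Longrightarrow> c x = c y"
    "\<And>x y. touched x \<Longrightarrow> y \<in> A \<Longrightarrow> adj G x y \<Longrightarrow> c x \<noteq> c y"
    using touched_colouring by blast
  have "finite (verts G)"
    using simple by (simp add: simple_graph_def)
  then obtain f :: "'a \<Rightarrow> nat" where f: "inj_on f (verts G)"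
    using finite_imp_inj_to_nat_seg by blast
  \<comment> \<open>The vertices of \<open>A\<^sub>2\<close> that are touched or matched to a touched vertex keep their
    colour.\<close>
  define near where "near x \<longleftrightarrow> touched x \<or> (\<exists>y \<in> A. adj G x y \<and> touched y)" for x
  define d where
    "d x \<longleftrightarrow> (if near x then c x else \<exists>y \<in> A. adj G x y \<and> f x < f y)" for x
  show thesis
  proof (rule that[of d])
    show "d x = d y" if "bad Q" "x \<in> N Q" "y \<in> N Q" for x y Q
    proof -
      have "near x" "near y"
        unfolding near_def touched_def using that by blast+
      then show ?thesis
        using c(1)[OF that] by (simp add: d_def)
    qed
    show "d x \<noteq> d y" if x: "x \<in> A" and y: "y \<in> A" and xy: "adj G x y" for x y
    proof -
      have yx: "adj G y x"
        using xy by (auto simp: commute)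
      have ux: "z = y" if "z \<in> A" "adj G x z" for z
        using A_matching[OF that(1) x y that(2) xy] .
      have uy: "z = x" if "z \<in> A" "adj G y z" for z
        using A_matching[OF that(1) y x that(2) yx] .
      have near: "near x \<longleftrightarrow> touched x \<or> touched y" "near y \<longleftrightarrow> touched x \<or> touched y"
        unfolding near_def using ux uy x y xy yx by metis+
      show ?thesis
      proof (cases "touched x \<or> touched y")
        case True
        then show ?thesis
          using c(2)[OF _ y xy] c(2)[OF _ x yx] near by (auto simp: d_def)
      next
        case False
        have "x \<noteq> y"
          using xy adj_irrefl[OF simple] by blast
        then have "f x \<noteq> f y"
          using f A_D(1)[OF x] A_D(1)[OF y] by (auto dest: inj_onD)
        moreover have "d x \<longleftrightarrow> f x < f y" "d y \<longleftrightarrow> f y < f x"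
          unfolding d_def using False near ux uy x y xy yx by metis+
        ultimately show ?thesis
          by linarith
      qed
    qed
  qed
qed

end

section \<open>Bipartiteness of the contracted graph\<close>

lemma bipartite_contracted:
  fixes c :: "'a \<Rightarrow> bool"
  assumes const: "\<And>x y. adj S x y \<Longrightarrow> c x = c y"
    and proper: "\<And>x y. adj (induced G X) x y \<Longrightarrow> c x \<noteq> c y"
  shows "bipartite (contracted G X S)"
proof -
  have step: "c x = c y" if "(adj S)\<^sup>*\<^sup>* x y" for x y
    using that by induction (auto dest: const)
  have comp: "c x = c y" if C: "C \<in> components S" "x \<in> C" "y \<in> C" for C x y
  proof -
    obtain z where "(adj S)\<^sup>*\<^sup>* z x" "(adj S)\<^sup>*\<^sup>* z y"
      using C by (auto simp: components_def component_of_def)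
    then show ?thesis
      using step[of z x] step[of z y] by simp
  qed
  define P where "P C \<longleftrightarrow> (\<exists>x \<in> C. c x)" for C
  have P: "P C \<longleftrightarrow> c x" if "C \<in> components S" "x \<in> C" for C x
    unfolding P_def using that comp[OF that(1)] by metis
  let ?X = "{C \<in> components S. P C}" and ?Y = "{C \<in> components S. \<not> P C}"
  have "\<exists>C \<in> ?X. \<exists>D \<in> ?Y. e = {C, D}" if e: "e \<in> edges (contracted G X S)" for e
  proof -
    obtain C D x y where CD: "e = {C, D}" "C \<in> components S" "D \<in> components S"
      "x \<in> C" "y \<in> D" "adj (induced G X) x y"
      using e by (auto simp: contracted_def)
    have "P C \<noteq> P D"
      using P[of C x] P[of D y] CD proper[of x y] by simp
    then show ?thesis
      using CD by (cases "P C") (auto simp: insert_commute)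
  qed
  then show ?thesis
    unfolding bipartite_def
    by (intro exI[of _ ?X] exI[of _ ?Y]) (auto simp: contracted_def)
qed

theorem lemma2p7:
  fixes G H S :: "'a graph"
    and u1 u2 u3 u4 :: 'a
    and A2 B13 C2 C4 :: "'a set"
    and \<Gamma> :: "'a set graph"
  assumes "simple_graph G"
    and "connected_graph G"
    and "free_of P6 G" and "free_of dart G" and "free_of K4 G"
    and "\<not> (\<exists>K. clique_cutset G K)"
    and "distinct [u1, u2, u3, u4]"
    and "{u1, u2, u3, u4} \<subseteq> verts G"
    and "H = induced G {u1, u2, u3, u4}"
    and "edges H = {{u1, u2}, {u2, u3}, {u3, u4}, {u4, u1}, {u1, u3}}"
    and "A2 = attached G H {u2}"
    and "B13 = attached G H {u1, u3}"
    and "C2 = attached G H {u2, u3, u4}"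
    and "C4 = attached G H {u4, u1, u2}"
    and "C2 = {}" and "C4 = {}" and "B13 \<noteq> {}"
    and "S = aux_graph G H A2 B13"
    and "\<Gamma> = contracted G A2 S"
  shows "bipartite \<Gamma>"
proof -
  have H_adj: "adj G x y \<longleftrightarrow>
      {x, y} \<in> {{u1, u2}, {u2, u3}, {u3, u4}, {u4, u1}, {u1, u3}}"
    if "x \<in> {u1, u2, u3, u4}" "y \<in> {u1, u2, u3, u4}" for x y
    using assms(9) that unfolding assms(10)[symmetric]
    by (auto simp: adj_def induced_def)
  interpret diamond_in_graph G H u1 u2 u3 u4
  proof
    show "adj G u1 u2" "adj G u1 u4"
      by (subst H_adj; auto simp: insert_commute)+
    show "\<not> adj G u2 u4"
      using assms(7) by (subst H_adj) (auto simp: doubleton_eq_iff)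
  qed (use assms in auto)
  obtain c :: "'a \<Rightarrow> bool" where c: "\<And>x y Q. bad Q \<Longrightarrow> x \<in> N Q \<Longrightarrow> y \<in> N Q \<Longrightarrow> c x = c y"
    "\<And>x y. x \<in> A \<Longrightarrow> y \<in> A \<Longrightarrow> adj G x y \<Longrightarrow> c x \<noteq> c y"
    using colouring by blast
  show ?thesis
    unfolding assms(19)
  proof (rule bipartite_contracted[of S c])
    show "c x = c y" if xy: "adj S x y" for x y
    proof -
      obtain Q where "bad Q" "x \<in> N Q" "y \<in> N Q"
        using xy unfolding assms(18,11,12)
        by (auto simp: adj_def aux_graph_def doubleton_eq_iff)
      then show ?thesis
        by (rule c(1))
    qed
    show "c x \<noteq> c y" if "adj (induced G A2) x y" for x y
      using that c(2) unfolding assms(11) by (auto simp: adj_induced)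
  qed
qed

end
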